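(* Let $p$ be an odd prime, let $c\in\mathbb{C}^{p-1}$, and let $A_p[c]=\left[c(i^{-1}\cdot j\,(\mathbb{Z}_p))\right]_{i,j=1}^{p-1}$. Fix a primitive $h$ of $\mathbb{Z}_p$ and let $f_c(z)=\sum_{k=1}^{p-1}c(h^k\,(\mathbb{Z}_p))\,z^k$. For $\ell=1,\dots,p-1$ let $z_\ell=\exp\left(2\pi i\frac{\ell}{p-1}\right)$ (where $i=\sqrt{-1}$) and $\nu_\ell=\sum_{j=1}^{p-1}z_\ell^j\,e_{(h^j\,(\mathbb{Z}_p))}\in\mathbb{C}^{p-1}$, where $e_a$ is the $a$th standard unit column vector. Let $J$ be the $(p-1)\times(p-1)$ reversal matrix. Then: (i) $A_p[c]$ is a Latin square matrix if the entries of $c$ are distinct. (ii) $A_p[c]$ is centrosymmetric. (iii) $A_p[c]$ has constant diagonal $c(1)$ and constant antidiagonal $c(p-1)$. (iv) $A_p[c]$ is permutation-similar to the circulant matrix whose first row is $[c(h^{k-1}\,(\mathbb{Z}_p))]_{k=1}^{p-1}$. (v) $A_p[c]$ is normal. (vi) The eigenvectors of $A_p[c]$ are given by $\nu_\ell$, $\ell=1,\dots,p-1$ (these form a complete set of eigenvectors), with corresponding eigenvalues $\lambda_\ell(c)=f_c(z_\ell)$. (vii) For even $\ell$, $J\nu_\ell=\nu_\ell$ holds, and for odd $\ell$, $J\nu_\ell=-\nu_\ell$ holds. In particular, there is an eigenvector $v$ of $A_p[c]$ with all entries in $\{1,-1\}$, which satisfies $Jv=v$ if $p\equiv 1 \pmod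 4$, and $Jv=-v$ if $p\equiv 3\pmod 4$. (viii) $\det A_p[c]=\prod_{\ell=1}^{p-1}f_c(z_\ell)$. In particular, $A_p[c]$ is invertible provided that $f_c$ has no roots among the $(p-1)$st roots of unity. (ix) For any $c,c'\in\mathbb{C}^{p-1}$, $\{A_p[c],\,A_p[c'],\,A_p[c]^*,\,A_p[c']^*\}$ is a commuting family, where $^*$ denotes conjugate transpose.
   Context: For an integer $a$ and an integer $p>1$, $a\,(\mathbb{Z}_p)$ denotes the remainder $r\in\{0,1,\dots,p-1\}$ of $a$ on division by $p$, regarded as an integer. For an odd prime $p$ and $1\le i\le p-1$, $i^{-1}$ denotes the multiplicative inverse of $i$ modulo $p$. For a vector $c\in\mathbb{C}^{p-1}$, $c(k)$ denotes its $k$th entry, $1\le k\le p-1$. A nonzero element $h$ of $\mathbb{Z}_p$ is called primitive (a primitive of $\mathbb{Z}_p$) if $\{h^k\,(\mathbb{Z}_p):1\le k\le p-1\}=\{1,2,\dots,p-1\}$. A Latin square matrix is a square matrix in which each row can be obtained by permuting the entries of any other row and each column can be obtained by permuting the entries of any other column. An $n\times n$ matrix $A$ is centrosymmetric if $A(i,j)=A(n-i+1,n-j+1)$ for $1\le i,j\le n$. The antidiagonal entries of a $(p-1)\times(p-1)$ matrix are those at positions $(i,p-i)$. The $n\times n$ reversal matrix $J$ has $J(i,j)=1$ if $i+j=n+1$ and $0$ otherwise. A square matrix $A$ is permutation-similar to $C$ if there is a permutation matrix $P$ with $PAP^T=C$. The $n\times n$ circulant matrix with first row $[c_0,\dots,c_{n-1}]$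 is the matrix with $(i,j)$ entry $c_{(j-i)\bmod n}$. A matrix is normal if it commutes with its conjugate transpose. *)

theory Defs
  imports
    "Jordan_Normal_Form.Char_Poly"
    "Jordan_Normal_Form.Schur_Decomposition"
    "Jordan_Normal_Form.VS_Connect"
    "HOL-Number_Theory.Number_Theory"
begin

text \<open>Vectors and matrices are indexed from 0 in the library, from 1 in the mathematics below;
  the next two abbreviations are the 1-based entries.\<close>

abbreviation vec_entry :: "'a vec \<Rightarrow> nat \<Rightarrow> 'a" where
  "vec_entry v k \<equiv> v $ (k - 1)"

abbreviation mat_entry :: "'a mat \<Rightarrow> nat \<Rightarrow> nat \<Rightarrow> 'a" where
  "mat_entry A i j \<equiv> A $$ (i - 1, j - 1)"


definition latin_square_mat :: "'a mat \<Rightarrow> bool" where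
  "latin_square_mat A \<longleftrightarrow> square_mat A \<and>
     (\<forall>i<dim_row A. \<forall>i'<dim_row A. \<exists>\<pi>. \<pi> permutes {..<dim_col A} \<and>
        (\<forall>j<dim_col A. A $$ (i', j) = A $$ (i, \<pi> j))) \<and>
     (\<forall>j<dim_col A. \<forall>j'<dim_col A. \<exists>\<pi>. \<pi> permutes {..<dim_row A} \<and>
        (\<forall>i<dim_row A. A $$ (i, j') = A $$ (\<pi> i, j)))"

definition centrosymmetric_mat :: "'a mat \<Rightarrow> bool" where
  "centrosymmetric_mat A \<longleftrightarrow> square_mat A \<and>
     (let n = dim_row A in
        \<forall>i\<in>{1..n}. \<forall>j\<in>{1..n}. mat_entry A i j = mat_entry A (n - i + 1) (n - j + 1))"

definition reversal_mat :: "nat \<Rightarrow> 'a :: zero_neq_one mat" where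
  "reversal_mat n = mat n n (\<lambda>(i, j). if Suc i + Suc j = n + 1 then 1 else 0)"

definition permutation_mat :: "nat \<Rightarrow> 'a :: zero_neq_one mat \<Rightarrow> bool" where
  "permutation_mat n P \<longleftrightarrow>
     (\<exists>\<pi>. \<pi> permutes {..<n} \<and> P = mat n n (\<lambda>(i, j). if j = \<pi> i then 1 else 0))"

definition permutation_similar_mat :: "'a :: semiring_1 mat \<Rightarrow> 'a mat \<Rightarrow> bool" where
  "permutation_similar_mat A C \<longleftrightarrow> square_mat A \<and>
     (\<exists>P. permutation_mat (dim_row A) P \<and> P * A * transpose_mat P = C)"

definition circulant_mat :: "'a vec \<Rightarrow> 'a mat" where
  "circulant_mat v = (let n = dim_vec v in
     mat n n (\<lambda>(i, j). v $ nat ((int j - int i) mod int n)))"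

definition normal_mat :: "complex mat \<Rightarrow> bool" where
  "normal_mat A \<longleftrightarrow> square_mat A \<and> A * mat_adjoint A = mat_adjoint A * A"

definition commuting_family :: "'a :: semiring_0 mat set \<Rightarrow> bool" where
  "commuting_family F \<longleftrightarrow> (\<forall>B\<in>F. \<forall>C\<in>F. B * C = C * B)"

text \<open>Elements of the residue ring modulo \<open>p\<close> are represented by their remainders.\<close>

definition primitive_mod :: "nat \<Rightarrow> nat \<Rightarrow> bool" where
  "primitive_mod p h \<longleftrightarrow> h \<in> {1..p - 1} \<and> (\<lambda>k. h ^ k mod p) ` {1..p - 1} = {1..p - 1}"

text \<open>\<^const>\<open>modular_inverse\<close> needs a ring, hence the detour through \<^typ>\<open>int\<close>.\<close>

definition A_mat :: "nat \<Rightarrow> complex vec \<Rightarrow> complex mat" where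
  "A_mat p c = mat (p - 1) (p - 1) (\<lambda>(i, j).
     vec_entry c (nat (modular_inverse (int p) (int (Suc i)) * int (Suc j) mod int p)))"

definition f_fun :: "nat \<Rightarrow> nat \<Rightarrow> complex vec \<Rightarrow> complex \<Rightarrow> complex" where
  "f_fun p h c z = (\<Sum>k=1..p - 1. vec_entry c (h ^ k mod p) * z ^ k)"

definition z_root :: "nat \<Rightarrow> nat \<Rightarrow> complex" where
  "z_root p l = exp (2 * complex_of_real pi * \<i> * (of_nat l / of_nat (p - 1)))"

definition nu_vec :: "nat \<Rightarrow> nat \<Rightarrow> nat \<Rightarrow> complex vec" where
  "nu_vec p h l = finsum_vec TYPE(complex) (p - 1)
     (\<lambda>j. z_root p l ^ j \<cdot>\<^sub>v unit_vec (p - 1) (h ^ j mod p - 1)) {1..p - 1}"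

text \<open>The finite family \<open>v\<close>, indexed by \<open>I\<close>, is a basis of the space of complex
  \<open>n\<close>-vectors. Injectivity is needed because the library's \<open>basis\<close> is a property of sets.\<close>

definition basis_family :: "nat \<Rightarrow> (nat \<Rightarrow> complex vec) \<Rightarrow> nat set \<Rightarrow> bool" where
  "basis_family n v I \<longleftrightarrow> inj_on v I \<and>
     vectorspace.basis (class_ring :: complex ring) (module_vec TYPE(complex) n) (v ` I)"

end

theory Submission
  imports Defs
begin

text \<open>Enumerating the nonzero residues as powers of the primitive element \<open>h\<close> turns \<open>i\<^sup>-\<^sup>1 j\<close>
  into a difference of exponents modulo \<open>p - 1\<close>, so \<open>A\<^sub>p[c]\<close> is a circulant in disguise.
  Its eigenvectors are the characters of the cyclic group of exponents; they are orthogonal and do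
  not depend on \<open>c\<close>, so all these matrices are diagonalised simultaneously. Since
  \<open>h\<close> to the power \<open>(p - 1) / 2\<close> is \<open>- 1\<close> modulo \<open>p\<close>, the
  reversal is the shift of exponents by \<open>(p - 1) / 2\<close>.\<close>

section \<open>Permutations, adjoints and determinants\<close>

lemma bij_betw_transport_permutes:
  assumes "bij_betw F K S" "bij_betw G K S"
  shows "\<exists>\<pi>. \<pi> permutes S \<and> (\<forall>k\<in>K. \<pi> (G k) = F k)"
proof (intro exI conjI ballI)
  \<comment> \<open>\<open>F\<close> after the inverse of \<open>G\<close>, continued by the
    identity outside \<open>S\<close> as \<open>permutes\<close> demands.\<close>
  let ?\<pi> = "\<lambda>x. if x \<in> S then F (the_inv_into K G x) else x"
  have "bij_betw (F \<circ> the_inv_into K G) S S"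
    using assms bij_betw_the_inv_into bij_betw_trans by blast
  then have "bij_betw ?\<pi> S S"
    by (rule bij_betw_cong[THEN iffD1, rotated]) simp
  then show "?\<pi> permutes S"
    by (rule bij_imp_permutes) simp
  show "?\<pi> (G k) = F k" if "k \<in> K" for k
    using that assms by (auto simp: bij_betw_def the_inv_into_f_f)
qed

lemma mat_adjoint_carrier:
  "A \<in> carrier_mat n m \<Longrightarrow> mat_adjoint A \<in> carrier_mat m n"
  by (auto simp: mat_adjoint_def)

lemma index_mat_adjoint:
  assumes "A \<in> carrier_mat n m" "i < m" "j < n"
  shows "mat_adjoint A $$ (i, j) = conjugate (A $$ (j, i))"
  using assms by (auto simp: mat_adjoint_def mat_of_rows_def)

lemma invertible_mat_det:
  fixes A :: "'a :: field mat"
  assumes A: "A \<in> carrier_mat n n" and "det A \<noteq> 0"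
  shows "invertible_mat A"
proof -
  obtain B where "B \<in> carrier_mat n n" "A * B = 1\<^sub>m n" "B * A = 1\<^sub>m n"
    using det_non_zero_imp_unit[OF assms, of "()"] by (auto simp: Units_def ring_mat_def)
  with A show ?thesis
    unfolding invertible_mat_def inverts_mat_def by auto
qed

lemma mult_mat_diag:
  fixes V :: "'a :: comm_semiring_1 mat"
  assumes V: "V \<in> carrier_mat n n" and "i < n" "l < n"
  shows "(V * mat n n (\<lambda>(i, j). if i = j then d i else 0)) $$ (i, l) = d l * V $$ (i, l)"
proof -
  have "(V * mat n n (\<lambda>(i, j). if i = j then d i else 0)) $$ (i, l) =
        (\<Sum>k\<in>{0..<n}. V $$ (i, k) * (if k = l then d k else 0))"
    using assms by (simp add: scalar_prod_def)
  also have "\<dots> = d l * V $$ (i, l)"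
    using assms by (simp add: if_distrib mult.commute cong: if_cong)
  finally show ?thesis .
qed

section \<open>The roots of unity \<open>z_root\<close>\<close>

lemma z_root_cis: "z_root p l = cis (2 * pi * real l / real (p - 1))"
  by (simp add: z_root_def cis_conv_exp mult_ac)

lemma z_root_pow:
  assumes "p > 1"
  shows "z_root p l ^ (p - 1) = 1"
proof -
  have "real (p - 1) * (2 * pi * real l / real (p - 1)) = 2 * pi * real l"
    using assms by simp
  then show ?thesis
    by (simp only: z_root_cis Complex.DeMoivre) (simp add: cis_multiple_2pi)
qed

lemma z_root_inj:
  assumes "p > 1"
  shows "inj_on (z_root p) {1..p - 1}"
proof (rule inj_onI)
  \<comment> \<open>\<open>bij_betw_roots_unity\<close> counts the roots from 0, here they are
    counted from 1: the last index \<open>p - 1\<close> is folded to 0.\<close>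
  have mod: "z_root p l = cis (2 * pi * real (l mod (p - 1)) / real (p - 1))"
    if "l \<in> {1..p - 1}" for l
    using that assms by (cases "l = p - 1") (auto simp: z_root_cis)
  fix l m assume lm: "l \<in> {1..p - 1}" "m \<in> {1..p - 1}" "z_root p l = z_root p m"
  then have "l mod (p - 1) = m mod (p - 1)"
    using bij_betw_imp_inj_on[OF bij_betw_roots_unity[of "p - 1"]] assms
    by (auto simp: mod[of l] mod[of m] dest: inj_onD)
  moreover have "k mod (p - 1) = (if k = p - 1 then 0 else k)" if "k \<in> {1..p - 1}" for k
    using that by auto
  ultimately show "l = m"
    using lm by (auto split: if_splits)
qed

lemma norm_z_root: "norm (z_root p l) = 1"
  by (simp add: z_root_cis)

text \<open>Half of the full exponent \<open>p - 1\<close> turns the angle by \<open>l * pi\<close>.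
  Oddness of \<open>p\<close> makes the truncated division exact.\<close>

lemma z_root_half:
  assumes "odd p" "p > 1"
  shows "z_root p l ^ ((p - 1) div 2) = (- 1) ^ l"
proof -
  have half: "real ((p - 1) div 2) = real (p - 1) / 2"
    using assms by (auto elim!: oddE)
  have "real ((p - 1) div 2) * (2 * pi * real l / real (p - 1)) = real l * pi"
    unfolding half using assms by simp
  then show ?thesis
    by (simp only: z_root_cis Complex.DeMoivre flip: cis_pi)
qed

lemma sum_powers_root_unity:
  fixes w :: "'a :: field"
  assumes "w ^ n = 1"
  shows "(\<Sum>k=1..n. w ^ k) = (if w = 1 then of_nat n else 0)"
proof (cases "w = 1")
  case False
  \<comment> \<open>Splitting off one factor \<open>w\<close> shifts the range to start at 0, where
    the geometric sum formula applies.\<close>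
  have "(\<Sum>k=1..n. w ^ k) = w * (\<Sum>k<n. w ^ k)"
    by (simp add: sum_distrib_left sum.atLeast1_atMost_eq)
  also have "(\<Sum>k<n. w ^ k) = 0"
    using geometric_sum[OF False, of n] assms by simp
  finally show ?thesis
    using False by simp
qed simp

section \<open>Matrix entries without modular inverses\<close>

lemma A_mat_carrier [simp]: "A_mat p c \<in> carrier_mat (p - 1) (p - 1)"
  by (simp add: A_mat_def)

lemma dim_A_mat [simp]: "dim_row (A_mat p c) = p - 1" "dim_col (A_mat p c) = p - 1"
  by (simp_all add: A_mat_def)

text \<open>Multiplying the congruence by the inverse of \<open>i\<close> isolates \<open>k\<close>,
  which is its own remainder. Later arguments about entries only need to verify a product modulo
  \<open>p\<close>.\<close>

lemma A_mat_entry: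
  assumes p: "prime p" and ijk: "i \<in> {1..p - 1}" "j \<in> {1..p - 1}" "k \<in> {1..p - 1}"
    and eq: "[i * k = j] (mod p)"
  shows "mat_entry (A_mat p c) i j = vec_entry c k"
proof -
  let ?v = "modular_inverse (int p) (int i)"
  have "k < p"
    using ijk(3) unfolding atLeastAtMost_iff by linarith
  have "\<not> p dvd i"
    using ijk(1) by (auto dest!: dvd_imp_le)
  then have "coprime i p"
    using prime_imp_coprime[OF p] by (simp add: coprime_commute)
  then have v: "[?v * int i = 1] (mod int p)"
    by (intro cong_modular_inverse2) simp
  have "[?v * int j = ?v * (int i * int k)] (mod int p)"
    using eq by (intro cong_mult cong_refl) (simp flip: cong_int_iff add: cong_sym_eq)
  also have "?v * (int i * int k) = (?v * int i) * int k"
    by (simp add: mult.assoc)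
  also have "[\<dots> = 1 * int k] (mod int p)"
    by (rule cong_mult[OF v cong_refl])
  also have "1 * int k = int k" by simp
  finally have "?v * int j mod int p = int k"
    using ijk(3) \<open>k < p\<close> by (simp add: cong_def)
  moreover have "i - 1 < p - 1" "j - 1 < p - 1" "Suc (i - 1) = i" "Suc (j - 1) = j"
    using ijk unfolding atLeastAtMost_iff by linarith+
  ultimately show ?thesis
    unfolding A_mat_def by simp
qed

section \<open>Exponents of the primitive element as coordinates\<close>

locale odd_prime_primitive =
  fixes p h :: nat
  assumes p: "prime p" "odd p"
    and h: "primitive_mod p h"
begin

declare One_nat_def [simp del]

abbreviation n :: nat where "n \<equiv> p - 1"

text \<open>The 0-based matrix index of the residue \<open>h ^ k\<close>.\<close>

definition pos :: "nat \<Rightarrow> nat" where "pos k = h ^ k mod p - 1"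

lemma p_gt: "p > 2"
  using p prime_ge_2_nat[of p] by (cases "p = 2") auto

lemma n_eq: "n div 2 + n div 2 = n" "0 < n div 2" "n div 2 < n"
  using p_gt p by (auto elim!: oddE)

lemma not_dvd_pow: "\<not> p dvd h ^ k"
proof
  assume "p dvd h ^ k"
  then have "p dvd h"
    using p prime_dvd_power_nat by blast
  with h p_gt show False
    by (auto simp: primitive_mod_def dest!: dvd_imp_le)
qed

lemma coprime_pow: "coprime (h ^ k) p"
  using prime_imp_coprime[OF p(1) not_dvd_pow] by (simp add: coprime_commute)

lemma pow_range: "h ^ k mod p \<in> {1..n}"
  using not_dvd_pow[of k] p_gt mod_less_divisor[of p "h ^ k"]
  by (auto simp: dvd_eq_mod_eq_0 Suc_le_eq simp del: mod_less_divisor)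

lemma Suc_pos: "Suc (pos k) = h ^ k mod p"
  using pow_range[of k] by (simp add: pos_def)

lemma pos_less: "pos k < n"
  using pow_range[of k] by (auto simp: pos_def)

lemma pow_n: "[h ^ n = 1] (mod p)"
  using fermat_theorem[OF p(1), of h] not_dvd_pow[of 1] by simp

text \<open>By Fermat, whole multiples of \<open>n\<close> in the exponent contribute a factor
  1.\<close>

lemma pow_mod_cong:
  assumes "[a = b] (mod n)"
  shows "h ^ a mod p = h ^ b mod p"
proof -
  have "[h ^ k = h ^ (k mod n)] (mod p)" for k
  proof -
    have "h ^ k = (h ^ n) ^ (k div n) * h ^ (k mod n)"
      by (simp flip: power_mult power_add)
    also have "[\<dots> = 1 ^ (k div n) * h ^ (k mod n)] (mod p)"
      by (intro cong_mult cong_pow pow_n cong_refl)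
    finally show ?thesis by simp
  qed
  from this[of a] this[of b] assms show ?thesis
    by (simp add: cong_def)
qed

lemma pos_cong: "[a = b] (mod n) \<Longrightarrow> pos a = pos b"
  by (simp add: pos_def pow_mod_cong)

text \<open>Primitivity is surjectivity between finite sets of equal size.\<close>

lemma pow_inj: "inj_on (\<lambda>k. h ^ k mod p) {1..n}"
  by (rule eq_card_imp_inj_on) (use h in \<open>auto simp: primitive_mod_def\<close>)

text \<open>A shift of exponents is multiplication by the unit \<open>h ^ a\<close>, which can be
  cancelled; surjectivity follows by counting. The free base point \<open>a\<close> allows each row
  to be enumerated relative to its own index.\<close>

lemma bij_pos_shift: "bij_betw (\<lambda>k. pos (a + k)) {1..n} {..<n}"
proof -
  have inj: "inj_on (\<lambda>k. pos (a + k)) {1..n}"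
  proof (rule inj_onI)
    fix k m assume km: "k \<in> {1..n}" "m \<in> {1..n}" and eq: "pos (a + k) = pos (a + m)"
    from eq have "[h ^ a * h ^ k = h ^ a * h ^ m] (mod p)"
      using Suc_pos[of "a + k"] Suc_pos[of "a + m"] by (simp add: cong_def power_add)
    then have "h ^ k mod p = h ^ m mod p"
      using cong_mult_lcancel_nat[OF coprime_pow] by (simp add: cong_def)
    then show "k = m"
      using pow_inj km by (auto dest: inj_onD)
  qed
  moreover have "(\<lambda>k. pos (a + k)) ` {1..n} = {..<n}"
    by (rule card_subset_eq) (use pos_less card_image[OF inj] in auto)
  ultimately show ?thesis
    by (simp add: bij_betw_def)
qed

lemma bij_pos: "bij_betw pos {1..n} {..<n}"
  using bij_pos_shift[of 0] by simp

lemma sum_pos_shift: "(\<Sum>i\<in>{0..<n}. F i) = (\<Sum>k=1..n. F (pos (a + k)))"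
  using sum.reindex_bij_betw[OF bij_pos_shift, of F a] by (simp add: lessThan_atLeast0)

lemma pos_cases:
  assumes "i < n"
  obtains k where "k \<in> {1..n}" "i = pos (a + k)"
proof -
  have "i \<in> (\<lambda>k. pos (a + k)) ` {1..n}"
    using assms bij_betw_imp_surj_on[OF bij_pos_shift] by simp
  then show ?thesis
    using that by blast
qed

text \<open>The power is a square root of 1 modulo the prime \<open>p\<close>, hence 1 or -1; its
  remainder \<open>n\<close> stands for -1.\<close>

lemma pow_half: "h ^ (n div 2) mod p = n"
proof -
  let ?x = "int (h ^ (n div 2))"
  have "?x ^ 2 = int (h ^ n)"
    by (simp only: of_nat_power[symmetric] power2_eq_square power_add[symmetric] n_eq flip: of_nat_mult)
  moreover have "[int (h ^ n) = int 1] (mod int p)"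
    using pow_n by (subst cong_int_iff)
  ultimately have "int p dvd (?x - 1) * (?x + 1)"
    by (simp add: cong_iff_dvd_diff power2_eq_square algebra_simps)
  then have "int p dvd ?x - 1 \<or> int p dvd ?x + 1"
    using p by (subst (asm) prime_dvd_mult_iff) auto
  \<comment> \<open>The value 1 is already taken at exponent \<open>n\<close>, so
    \<open>pow_inj\<close> excludes it here.\<close>
  moreover have "\<not> int p dvd ?x - 1"
  proof
    assume "int p dvd ?x - 1"
    then have "[?x = int 1] (mod int p)"
      by (simp add: cong_iff_dvd_diff)
    then have "h ^ (n div 2) mod p = h ^ n mod p"
      using pow_n by (simp only: cong_int_iff) (simp add: cong_def)
    then show False
      using inj_onD[OF pow_inj, of "n div 2" n] n_eq by auto
  qed
  ultimately have "int p dvd int (h ^ (n div 2) + 1)"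
    by (simp add: add.commute)
  then have "p dvd h ^ (n div 2) + 1"
    by (simp only: int_dvd_int_iff)
  \<comment> \<open>The remainder plus 1 is a positive multiple of \<open>p\<close>, which leaves
    only the largest remainder \<open>n\<close>.\<close>
  then have "(h ^ (n div 2) mod p + 1) mod p = 0"
    by (simp add: mod_simps)
  then have "\<not> h ^ (n div 2) mod p + 1 < p"
    by auto
  moreover have "h ^ (n div 2) mod p \<le> n"
    using pow_range by simp
  ultimately show ?thesis
    using p_gt by linarith
qed

text \<open>Adding \<open>n div 2\<close> to the exponent multiplies by -1 and so sends a residue
  \<open>r\<close> to \<open>p - r\<close>; on indices from 0 this is the reversal.\<close>

lemma pos_add_half: "pos (a + n div 2) = n - Suc (pos a)"
proof -
  have "[Suc (pos (a + n div 2)) = Suc (pos a) * n] (mod p)"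
  proof -
    have "[h ^ a mod p * (h ^ (n div 2) mod p) = h ^ (a + n div 2) mod p] (mod p)"
      by (simp add: cong_def power_add mod_simps)
    then show ?thesis
      by (simp add: Suc_pos pow_half cong_sym_eq)
  qed
  then have "[int (Suc (pos (a + n div 2))) = int (Suc (pos a)) * int n] (mod int p)"
    by (simp only: cong_int_iff flip: of_nat_mult)
  also have "[int (Suc (pos a)) * int n = int (p - Suc (pos a))] (mod int p)"
  proof -
    have "int (Suc (pos a)) * int n - int (p - Suc (pos a)) = int p * int (pos a)"
      using pos_less[of a] p_gt by (simp add: of_nat_diff algebra_simps)
    then show ?thesis
      by (simp add: cong_iff_dvd_diff)
  qed
  finally have "[Suc (pos (a + n div 2)) = p - Suc (pos a)] (mod p)"
    by (simp only: cong_int_iff)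
  then have "Suc (pos (a + n div 2)) = p - Suc (pos a)"
    using pos_less[of a] pos_less[of "a + n div 2"] by (simp add: cong_def)
  then show ?thesis
    by linarith
qed

text \<open>The quotient of \<open>h ^ (a + k)\<close> by \<open>h ^ a\<close> is
  \<open>h ^ k\<close>: in exponent coordinates the entry depends only on the difference.\<close>

lemma A_mat_pos: "A_mat p c $$ (pos a, pos (a + k)) = c $ pos k"
proof -
  have "[Suc (pos a) * Suc (pos k) = Suc (pos (a + k))] (mod p)"
    unfolding Suc_pos power_add by (simp add: cong_def mod_simps)
  from A_mat_entry[OF p(1) _ _ _ this, of c] show ?thesis
    using pos_less[of a] pos_less[of k] pos_less[of "a + k"] by simp
qed

text \<open>Multiplying both indices by \<open>h ^ m\<close> leaves their quotient
  unchanged.\<close>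

lemma A_mat_pos_shift: "A_mat p c $$ (pos (a + m), pos (b + m)) = A_mat p c $$ (pos a, pos b)"
proof -
  obtain k where k: "pos b = pos (a + k)"
    using pos_cases[OF pos_less] by metis
  have "pos (b + m) = pos (a + m + k)"
  proof -
    have "[h ^ b = h ^ (a + k)] (mod p)"
      using k Suc_pos[of b] Suc_pos[of "a + k"] by (simp add: cong_def)
    then have "[h ^ b * h ^ m = h ^ (a + k) * h ^ m] (mod p)"
      by (rule cong_mult) simp
    then show ?thesis
      by (simp add: pos_def cong_def power_add mult_ac)
  qed
  then show ?thesis
    by (simp add: A_mat_pos k)
qed

section \<open>Latin square, symmetry, diagonals and circulant form\<close>

lemma latin_square_A_mat: "latin_square_mat (A_mat p c)"
proof -
  let ?A = "A_mat p c"
  have "\<exists>\<pi>. \<pi> permutes {..<n} \<and> (\<forall>j<n. ?A $$ (i', j) = ?A $$ (i, \<pi> j))"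
    if i: "i < n" "i' < n" for i i'
  proof -
    obtain a b where ab: "i = pos a" "i' = pos b"
      using i pos_cases by metis
    \<comment> \<open>Row \<open>pos b\<close> at column \<open>pos (b + k)\<close> and row
      \<open>pos a\<close> at column \<open>pos (a + k)\<close> both carry \<open>c $ pos k\<close>,
      so \<pi> matches these columns.\<close>
    obtain \<pi> where \<pi>: "\<pi> permutes {..<n}" "\<forall>k\<in>{1..n}. \<pi> (pos (b + k)) = pos (a + k)"
      using bij_betw_transport_permutes[OF bij_pos_shift bij_pos_shift] by metis
    have "?A $$ (i', j) = ?A $$ (i, \<pi> j)" if "j < n" for j
      using pos_cases[OF that, of b] \<pi>(2) ab by (metis A_mat_pos)
    with \<pi>(1) show ?thesis by blast
  qed
  moreover have "\<exists>\<pi>. \<pi> permutes {..<n} \<and> (\<forall>i<n. ?A $$ (i, j') = ?A $$ (\<pi> i, j))"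
    if j: "j < n" "j' < n" for j j'
  proof -
    obtain a b where ab: "j = pos a" "j' = pos b"
      using j pos_cases by metis
    obtain \<pi> where \<pi>: "\<pi> permutes {..<n}" "\<forall>k\<in>{1..n}. \<pi> (pos (b + k)) = pos (a + k)"
      using bij_betw_transport_permutes[OF bij_pos_shift bij_pos_shift] by metis
    \<comment> \<open>Shifting back by \<open>b\<close> and by \<open>a\<close>, both entries equal
      the one at \<open>(pos k, pos 0)\<close>.\<close>
    have "?A $$ (i, j') = ?A $$ (\<pi> i, j)" if "i < n" for i
      using pos_cases[OF that, of b] \<pi>(2) ab A_mat_pos_shift[of c _ _ 0]
      by (metis A_mat_pos_shift add.commute add_0)
    with \<pi>(1) show ?thesis by blast
  qed
  ultimately show ?thesis
    by (simp add: latin_square_mat_def A_mat_def)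
qed

text \<open>Negating both indices keeps their quotient, and negation is the shift by
  \<open>n div 2\<close>.\<close>

lemma centrosymmetric_A_mat: "centrosymmetric_mat (A_mat p c)"
proof -
  have "mat_entry (A_mat p c) i j = mat_entry (A_mat p c) (n - i + 1) (n - j + 1)"
    if ij: "i \<in> {1..n}" "j \<in> {1..n}" for i j
  proof -
    have less: "i - 1 < n" "j - 1 < n"
      using ij unfolding atLeastAtMost_iff by linarith+
    obtain a b where ab: "i - 1 = pos a" "j - 1 = pos b"
      using pos_cases[OF less(1)] pos_cases[OF less(2)] by metis
    have "n - i = pos (a + n div 2)" "n - j = pos (b + n div 2)"
      using ij ab[symmetric] by (simp_all add: pos_add_half)
    then show ?thesis
      by (simp add: ab A_mat_pos_shift)
  qed
  then show ?thesis
    by (simp add: centrosymmetric_mat_def Let_def)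
qed

text \<open>The quotients are 1 on the diagonal and -1, represented by \<open>n\<close>, on the
  antidiagonal.\<close>

lemma diagonals_A_mat:
  assumes "i \<in> {1..n}"
  shows "mat_entry (A_mat p c) i i = vec_entry c 1"
    and "mat_entry (A_mat p c) i (p - i) = vec_entry c n"
proof -
  show "mat_entry (A_mat p c) i i = vec_entry c 1"
    by (rule A_mat_entry[OF p(1)]) (use assms p_gt in auto)
  have "int i * int n - int (p - i) = int p * (int i - 1)"
    using assms p_gt by (auto simp: of_nat_diff algebra_simps)
  then have "[int (i * n) = int (p - i)] (mod int p)"
    by (simp add: cong_iff_dvd_diff)
  then have "[i * n = p - i] (mod p)"
    by (simp only: cong_int_iff)
  then show "mat_entry (A_mat p c) i (p - i) = vec_entry c n"
    by (intro A_mat_entry[OF p(1)]) (use assms p_gt in auto)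
qed

lemma permutation_similar_A_mat:
  "permutation_similar_mat (A_mat p c)
     (circulant_mat (vec n (\<lambda>k. vec_entry c (h ^ k mod p))))"
proof -
  let ?A = "A_mat p c"
  let ?C = "circulant_mat (vec n (\<lambda>k. vec_entry c (h ^ k mod p)))"
  \<comment> \<open>Lists the residues in the order 1, \<open>h\<close>, \<open>h ^ 2\<close>, and
    so on. Exponents start at 0 to agree with circulant indexing, so exponent \<open>n\<close> of
    \<open>bij_pos\<close> has to be folded to 0 below.\<close>
  define \<pi> where "\<pi> i = (if i < n then pos i else i)" for i
  have "pos ` {..<n} = {..<n}"
  proof
    show "{..<n} \<subseteq> pos ` {..<n}"
    proof
      fix i assume "i \<in> {..<n}"
      then obtain k where "i = pos k"
        using pos_cases[of i 0] by auto
      then have "i = pos (k mod n)"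
        using pos_cong[of k "k mod n"] by (simp add: cong_def)
      then show "i \<in> pos ` {..<n}"
        using n_eq by simp
    qed
  qed (use pos_less in auto)
  then have "bij_betw pos {..<n} {..<n}"
    by (auto simp: bij_betw_def intro: eq_card_imp_inj_on)
  then have "bij_betw \<pi> {..<n} {..<n}"
    by (rule bij_betw_cong[THEN iffD1, rotated]) (simp add: \<pi>_def)
  then have perm: "\<pi> permutes {..<n}"
    by (rule bij_imp_permutes) (simp add: \<pi>_def)
  define P :: "complex mat" where "P = mat n n (\<lambda>(i, j). if j = \<pi> i then 1 else 0)"
  have less: "\<pi> i < n" if "i < n" for i
    using that by (simp add: \<pi>_def pos_less)
  have PA: "(P * ?A) $$ (i, j) = ?A $$ (\<pi> i, j)" if "i < n" "j < n" for i j
  proof -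
    have "(P * ?A) $$ (i, j) = (\<Sum>k\<in>{0..<n}. (if k = \<pi> i then 1 else 0) * ?A $$ (k, j))"
      using that by (simp add: P_def scalar_prod_def)
    also have "\<dots> = (\<Sum>k\<in>{0..<n}. if k = \<pi> i then ?A $$ (k, j) else 0)"
      by (rule sum.cong) auto
    finally show ?thesis
      using less[OF that(1)] by simp
  qed
  have "P * ?A * transpose_mat P = ?C"
  proof (rule eq_matI)
    fix i j assume "i < dim_row ?C" "j < dim_col ?C"
    then have ij: "i < n" "j < n"
      by (simp_all add: circulant_mat_def Let_def)
    have "(P * ?A * transpose_mat P) $$ (i, j) =
          (\<Sum>k\<in>{0..<n}. (P * ?A) $$ (i, k) * P $$ (j, k))"
      using ij A_mat_carrier[of p c] by (auto simp: P_def scalar_prod_def intro!: sum.cong)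
    also have "\<dots> = (\<Sum>k\<in>{0..<n}. if k = \<pi> j then ?A $$ (\<pi> i, k) else 0)"
      by (rule sum.cong) (use ij PA in \<open>auto simp: P_def\<close>)
    also have "\<dots> = ?A $$ (pos i, pos j)"
      using less[OF ij(2)] ij by (simp add: \<pi>_def)
    also have "\<dots> = c $ pos (nat ((int j - int i) mod int n))"
    proof -
      let ?k = "nat ((int j - int i) mod int n)"
      \<comment> \<open>The circulant offset is the exponent difference modulo \<open>n\<close>,
        which is all that \<open>pos\<close> sees.\<close>
      have "int (i + ?k) = int i + (int j - int i) mod int n"
        using ij by simp
      then have "[int (i + ?k) = int j] (mod int n)"
        by (simp add: cong_def mod_simps)
      then have "pos j = pos (i + ?k)"
        by (intro pos_cong) (simp only: cong_int_iff cong_sym_eq)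
      then show ?thesis
        by (simp add: A_mat_pos)
    qed
    also have "\<dots> = ?C $$ (i, j)"
      using ij by (simp add: circulant_mat_def Let_def pos_def nat_less_iff)
    finally show "(P * ?A * transpose_mat P) $$ (i, j) = ?C $$ (i, j)" .
  qed (simp_all add: P_def circulant_mat_def Let_def)
  then show ?thesis
    using perm by (auto simp: permutation_similar_mat_def permutation_mat_def A_mat_def P_def)
qed

section \<open>The eigenvectors\<close>

lemma nu_vec_carrier [simp]: "nu_vec p h l \<in> carrier_vec n"
  unfolding nu_vec_def by (rule finsum_vec_closed) auto

lemma dim_nu_vec [simp]: "dim_vec (nu_vec p h l) = n"
  using nu_vec_carrier by (rule carrier_vecD)

text \<open>In exponent coordinates \<open>nu_vec\<close> is a character of the cyclic group of
  order \<open>n\<close>; periodicity of both sides extends this to every \<open>k\<close>.\<close>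

lemma nu_vec_pos: "nu_vec p h l $ pos k = z_root p l ^ k"
proof -
  \<comment> \<open>The defining sum runs over exponents from 1 to \<open>n\<close>, so
    \<open>n\<close> represents the class of 0.\<close>
  obtain m where m: "m \<in> {1..n}" "[m = k] (mod n)"
  proof
    show "(if k mod n = 0 then n else k mod n) \<in> {1..n}"
      using p_gt by (auto simp: less_imp_le)
  qed (auto simp: cong_def)
  have "nu_vec p h l $ pos m =
        (\<Sum>j\<in>{1..n}. (z_root p l ^ j \<cdot>\<^sub>v unit_vec n (h ^ j mod p - 1)) $ pos m)"
    unfolding nu_vec_def by (rule index_finsum_vec) (auto simp: pos_less)
  also have "\<dots> = (\<Sum>j\<in>{1..n}. if j = m then z_root p l ^ j else 0)"
  proof (rule sum.cong)
    fix j assume j: "j \<in> {1..n}"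
    have "pos m = pos j \<longleftrightarrow> m = j"
      using j m bij_pos by (auto simp: bij_betw_def dest: inj_onD)
    then show "(z_root p l ^ j \<cdot>\<^sub>v unit_vec n (h ^ j mod p - 1)) $ pos m =
        (if j = m then z_root p l ^ j else 0)"
      using pos_less[of m] pos_less[of j] by (auto simp flip: pos_def)
  qed simp
  also have "\<dots> = z_root p l ^ m"
    using m by simp
  also have "\<dots> = z_root p l ^ k"
  proof -
    have "z_root p l ^ i = z_root p l ^ (i mod n)" for i
    proof -
      have "z_root p l ^ i = (z_root p l ^ n) ^ (i div n) * z_root p l ^ (i mod n)"
        by (simp flip: power_mult power_add)
      then show ?thesis
        using z_root_pow[of p l] p_gt by simp
    qed
    from this[of m] this[of k] m(2) show ?thesis
      by (simp add: cong_def)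
  qed
  finally show ?thesis
    using pos_cong[OF m(2)] by simp
qed

text \<open>Enumerating the columns from the row's own exponent \<open>a\<close> makes
  \<open>z ^ (a + k)\<close> split; the factor \<open>z ^ a\<close> is the entry of
  \<open>nu_vec\<close>, and the remaining sum is \<open>f_fun\<close>.\<close>

lemma A_mat_nu: "A_mat p c *\<^sub>v nu_vec p h l = f_fun p h c (z_root p l) \<cdot>\<^sub>v nu_vec p h l"
proof (rule eq_vecI)
  let ?A = "A_mat p c" and ?z = "z_root p l"
  show "dim_vec (?A *\<^sub>v nu_vec p h l) = dim_vec (f_fun p h c ?z \<cdot>\<^sub>v nu_vec p h l)"
    using nu_vec_carrier[of l] A_mat_carrier[of p c] by auto
  fix i assume "i < dim_vec (f_fun p h c ?z \<cdot>\<^sub>v nu_vec p h l)"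
  then have "i < n"
    using nu_vec_carrier[of l] by auto
  then obtain a where a: "i = pos a"
    using pos_cases by metis
  have "(?A *\<^sub>v nu_vec p h l) $ i = (\<Sum>j\<in>{0..<n}. ?A $$ (pos a, j) * nu_vec p h l $ j)"
    using pos_less[of a] nu_vec_carrier[of l] A_mat_carrier[of p c]
    by (auto simp: a scalar_prod_def intro!: sum.cong)
  also have "\<dots> = (\<Sum>k=1..n. c $ pos k * ?z ^ (a + k))"
    by (simp only: sum_pos_shift[where a = a] A_mat_pos nu_vec_pos)
  also have "\<dots> = f_fun p h c ?z * ?z ^ a"
    by (simp add: f_fun_def sum_distrib_left sum_distrib_right power_add pos_def mult_ac)
  also have "\<dots> = (f_fun p h c ?z \<cdot>\<^sub>v nu_vec p h l) $ i"
    using pos_less[of a] nu_vec_carrier[of l] by (simp add: a nu_vec_pos)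
  finally show "(?A *\<^sub>v nu_vec p h l) $ i = (f_fun p h c ?z \<cdot>\<^sub>v nu_vec p h l) $ i" .
qed

lemma eigenvector_nu: "eigenvector (A_mat p c) (nu_vec p h l) (f_fun p h c (z_root p l))"
proof -
  \<comment> \<open>The entry at exponent 0 is 1.\<close>
  have "nu_vec p h l $ pos 0 \<noteq> 0\<^sub>v n $ pos 0"
    using pos_less[of 0] by (simp add: nu_vec_pos)
  then have "nu_vec p h l \<noteq> 0\<^sub>v n"
    by metis
  then show ?thesis
    using A_mat_nu A_mat_carrier[of p c] by (simp add: eigenvector_def A_mat_def)
qed

section \<open>Completeness of the eigenvectors\<close>

definition nu_mat :: "complex mat" where
  "nu_mat = mat n n (\<lambda>(i, l). nu_vec p h (Suc l) $ i)"

lemma nu_mat_carrier [simp]: "nu_mat \<in> carrier_mat n n"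
  by (simp add: nu_mat_def)

lemma dim_nu_mat [simp]: "dim_row nu_mat = n" "dim_col nu_mat = n"
  by (simp_all add: nu_mat_def)

lemma col_nu_mat: "l < n \<Longrightarrow> col nu_mat l = nu_vec p h (Suc l)"
  by (rule eq_vecI) (use nu_vec_carrier[of "Suc l"] in \<open>auto simp: nu_mat_def\<close>)

text \<open>Orthogonality of the characters of a cyclic group: the Gram matrix of the
  \<^const>\<open>nu_vec\<close> is \<open>n\<close> times the identity.\<close>

lemma det_nu_mat: "det nu_mat \<noteq> 0"
proof -
  define W where "W = mat n n (\<lambda>(l, i). cnj (nu_mat $$ (i, l)))"
  have W: "W \<in> carrier_mat n n"
    by (simp add: W_def)
  have "W * nu_mat = of_nat n \<cdot>\<^sub>m 1\<^sub>m n"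
  proof (rule eq_matI)
    fix l m assume "l < dim_row (of_nat n \<cdot>\<^sub>m 1\<^sub>m n :: complex mat)"
      "m < dim_col (of_nat n \<cdot>\<^sub>m 1\<^sub>m n :: complex mat)"
    then have lm: "l < n" "m < n" by simp_all
    let ?z = "z_root p (Suc l)" and ?y = "z_root p (Suc m)"
    have "(W * nu_mat) $$ (l, m) =
          (\<Sum>i\<in>{0..<n}. cnj (nu_vec p h (Suc l) $ i) * nu_vec p h (Suc m) $ i)"
      using lm by (auto simp: W_def nu_mat_def scalar_prod_def intro!: sum.cong)
    also have "\<dots> = (\<Sum>k=1..n. (cnj ?z * ?y) ^ k)"
      by (simp only: sum_pos_shift[where a = 0] nu_vec_pos add_0 complex_cnj_power power_mult_distrib)
    also have "\<dots> = (if cnj ?z * ?y = 1 then of_nat n else 0)"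
    proof (rule sum_powers_root_unity)
      show "(cnj ?z * ?y) ^ n = 1"
        using z_root_pow[of p "Suc l"] z_root_pow[of p "Suc m"] p_gt
        by (simp add: power_mult_distrib flip: complex_cnj_power)
    qed
    also have "cnj ?z * ?y = 1 \<longleftrightarrow> l = m"
    proof -
      \<comment> \<open>On the unit circle the conjugate is the inverse, so the product is 1 exactly
        for equal roots.\<close>
      have zz: "?z * cnj ?z = 1"
        using norm_z_root[of p "Suc l"] by (simp add: complex_norm_square flip: complex_norm_square)
      have "cnj ?z * ?y = 1 \<longleftrightarrow> ?y = ?z"
      proof
        assume "cnj ?z * ?y = 1"
        then have "?z * cnj ?z * ?y = ?z"
          by (simp add: mult.assoc)
        then show "?y = ?z" using zz by simp
      qed (use zz in \<open>simp add: mult.commute\<close>)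
      also have "\<dots> \<longleftrightarrow> l = m"
        using inj_onD[OF z_root_inj, of p "Suc l" "Suc m"] lm p_gt by auto
      finally show ?thesis .
    qed
    finally show "(W * nu_mat) $$ (l, m) = (of_nat n \<cdot>\<^sub>m 1\<^sub>m n) $$ (l, m)"
      using lm by simp
  qed (simp_all add: W_def nu_mat_def)
  then have "det W * det nu_mat = of_nat n ^ n"
    using det_mult[OF W nu_mat_carrier] by (simp add: det_smult)
  then show ?thesis
    using p_gt by auto
qed

text \<open>The nonzero determinant makes these \<open>n\<close> vectors independent, and
  \<open>n\<close> is the dimension.\<close>

lemma basis_nu: "basis_family n (nu_vec p h) {1..n}"
proof -
  interpret vec_space "TYPE(complex)" n .
  have inj: "inj_on (nu_vec p h) {1..n}"
  proof (rule inj_onI)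
    fix l m assume lm: "l \<in> {1..n}" "m \<in> {1..n}" "nu_vec p h l = nu_vec p h m"
    \<comment> \<open>The entry at exponent 1 is the root itself.\<close>
    then have "z_root p l = z_root p m"
      using nu_vec_pos[of l 1] nu_vec_pos[of m 1] by simp
    then show "l = m"
      using inj_onD[OF z_root_inj, of p l m] lm p_gt by simp
  qed
  have cols: "set (cols nu_mat) = nu_vec p h ` {1..n}"
  proof -
    have "set (cols nu_mat) = (\<lambda>l. nu_vec p h (Suc l)) ` {0..<n}"
      using col_nu_mat by (auto simp: cols_def nu_mat_def)
    also have "\<dots> = nu_vec p h ` (Suc ` {0..<n})"
      by (simp only: image_image)
    also have "Suc ` {0..<n} = {1..n}"
      by (simp add: image_Suc_atLeastLessThan atLeastLessThanSuc_atLeastAtMost)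
    finally show ?thesis .
  qed
  have "lin_indpt (nu_vec p h ` {1..n})"
    using lin_dep_cols_imp_det_0[OF nu_mat_carrier] det_nu_mat cols by auto
  then have "basis (nu_vec p h ` {1..n})"
    by (intro dim_li_is_basis) (auto simp: card_image[OF inj] dim_is_n)
  with inj show ?thesis
    by (simp add: basis_family_def)
qed

section \<open>Commutation and normality\<close>

lemma mult_nu_mat_cancel:
  assumes M: "M \<in> carrier_mat n n" and N: "N \<in> carrier_mat n n"
    and eq: "\<And>l. M *\<^sub>v nu_vec p h l = N *\<^sub>v nu_vec p h l"
  shows "M = N"
proof -
  \<comment> \<open>Agreement on all \<open>nu_vec\<close> is equality after multiplication by
    \<open>nu_mat\<close>, which a right inverse cancels.\<close>
  obtain B where B: "B \<in> carrier_mat n n" "nu_mat * B = 1\<^sub>m n"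
    using det_non_zero_imp_unit[OF nu_mat_carrier det_nu_mat, of "()"]
    by (auto simp: Units_def ring_mat_def)
  have "M * nu_mat = N * nu_mat"
  proof (rule mat_col_eqI)
    fix l assume "l < dim_col (N * nu_mat)"
    then have l: "l < n" by (simp add: nu_mat_def)
    show "col (M * nu_mat) l = col (N * nu_mat) l"
      using l col_mult2[OF M nu_mat_carrier l] col_mult2[OF N nu_mat_carrier l] eq
      by (simp add: col_nu_mat)
  qed (use M N in auto)
  then have "M * (nu_mat * B) = N * (nu_mat * B)"
    using M N B(1) nu_mat_carrier by (metis assoc_mult_mat)
  then show ?thesis
    using M N B(2) by simp
qed

text \<open>Either product scales each \<open>nu_vec\<close> by the product of the two
  eigenvalues.\<close>

lemma A_mat_commute: "A_mat p c * A_mat p c' = A_mat p c' * A_mat p c"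
proof (rule mult_nu_mat_cancel)
  fix l
  have prod: "(A_mat p c * A_mat p c') *\<^sub>v nu_vec p h l =
      f_fun p h c' (z_root p l) \<cdot>\<^sub>v (f_fun p h c (z_root p l) \<cdot>\<^sub>v nu_vec p h l)" for c c'
    using assoc_mult_mat_vec[OF A_mat_carrier A_mat_carrier nu_vec_carrier, of c c' l]
      mult_mat_vec[OF A_mat_carrier nu_vec_carrier]
    by (simp add: A_mat_nu)
  show "(A_mat p c * A_mat p c') *\<^sub>v nu_vec p h l = (A_mat p c' * A_mat p c) *\<^sub>v nu_vec p h l"
    by (simp add: prod smult_smult_assoc mult.commute)
qed (auto intro: mult_carrier_mat[OF A_mat_carrier A_mat_carrier])

text \<open>The family is closed under adjoints, since an entry depends only on the ratio of its indices.\<close>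

lemma adjoint_A_mat: "\<exists>c'. mat_adjoint (A_mat p c) = A_mat p c'"
proof
  let ?A = "A_mat p c"
  \<comment> \<open>The first row of the adjoint: \<open>pos 0\<close> is the index of the residue
    1.\<close>
  let ?c' = "vec n (\<lambda>i. cnj (?A $$ (i, pos 0)))"
  show "mat_adjoint ?A = A_mat p ?c'"
  proof (rule eq_matI)
    fix i j assume "i < dim_row (A_mat p ?c')" "j < dim_col (A_mat p ?c')"
    then have ij: "i < n" "j < n" by (simp_all add: A_mat_def)
    obtain a where a: "i = pos a"
      using pos_cases[OF ij(1), of 0] by auto
    obtain k where k: "j = pos (a + k)"
      using pos_cases[OF ij(2), of a] by auto
    have "mat_adjoint ?A $$ (i, j) = cnj (?A $$ (pos (a + k), pos a))"
      using index_mat_adjoint[OF A_mat_carrier ij] by (simp add: a k)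
    also have "\<dots> = cnj (?A $$ (pos k, pos 0))"
      using A_mat_pos_shift[of c k a 0] by (simp add: add.commute)
    also have "\<dots> = A_mat p ?c' $$ (i, j)"
      using pos_less[of k] by (simp add: a k A_mat_pos)
    finally show "mat_adjoint ?A $$ (i, j) = A_mat p ?c' $$ (i, j)" .
  qed (use mat_adjoint_carrier[OF A_mat_carrier[of p c]] in \<open>simp_all add: A_mat_def\<close>)
qed

text \<open>All four members have the form \<open>A_mat p d\<close>, so one commutation law covers
  every pair.\<close>

lemma commuting_family_A_mat:
  "commuting_family {A_mat p c1, A_mat p c2, mat_adjoint (A_mat p c1), mat_adjoint (A_mat p c2)}"
proof -
  obtain d1 d2 where d: "mat_adjoint (A_mat p c1) = A_mat p d1" "mat_adjoint (A_mat p c2) = A_mat p d2"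
    using adjoint_A_mat by metis
  show ?thesis
    unfolding commuting_family_def d by (blast intro: A_mat_commute)
qed

lemma normal_A_mat: "normal_mat (A_mat p c)"
  using adjoint_A_mat[of c] A_mat_commute by (auto simp: normal_mat_def A_mat_def)

section \<open>Determinant and invertibility\<close>

lemma det_A_mat: "det (A_mat p c) = (\<Prod>l=1..n. f_fun p h c (z_root p l))"
proof -
  let ?d = "\<lambda>l. f_fun p h c (z_root p (Suc l))"
  define D where "D = mat n n (\<lambda>(i, j). if i = j then ?d i else 0)"
  have D: "D \<in> carrier_mat n n"
    by (simp add: D_def)
  \<comment> \<open>The eigenvector equations, column by column; the nonzero
    \<open>det nu_mat\<close> then cancels.\<close>
  have "A_mat p c * nu_mat = nu_mat * D"
  proof (rule eq_matI)
    fix i l assume "i < dim_row (nu_mat * D)" "l < dim_col (nu_mat * D)"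
    then have il: "i < n" "l < n" by (simp_all add: nu_mat_def D_def)
    have "(A_mat p c * nu_mat) $$ (i, l) = (A_mat p c *\<^sub>v nu_vec p h (Suc l)) $ i"
      using il A_mat_carrier[of p c] nu_mat_carrier by (simp add: col_nu_mat)
    also have "\<dots> = ?d l * nu_mat $$ (i, l)"
      using il nu_vec_carrier[of "Suc l"] by (simp add: A_mat_nu nu_mat_def)
    also have "\<dots> = (nu_mat * D) $$ (i, l)"
      unfolding D_def using il by (intro mult_mat_diag[symmetric]) auto
    finally show "(A_mat p c * nu_mat) $$ (i, l) = (nu_mat * D) $$ (i, l)" .
  qed (simp_all add: A_mat_def nu_mat_def D_def)
  then have "det (A_mat p c) * det nu_mat = det nu_mat * det D"
    by (metis det_mult A_mat_carrier nu_mat_carrier D)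
  then have "det (A_mat p c) = det D"
    using det_nu_mat by simp
  also have "\<dots> = prod_list (diag_mat D)"
    using D by (intro det_upper_triangular) (auto simp: D_def)
  also have "\<dots> = (\<Prod>l=0..<n. ?d l)"
    by (simp add: prod_list_diag_prod D_def)
  also have "\<dots> = (\<Prod>l=1..n. f_fun p h c (z_root p l))"
    by (simp add: One_nat_def prod.atLeast1_atMost_eq lessThan_atLeast0)
  finally show ?thesis .
qed

lemma invertible_A_mat:
  assumes "\<forall>z. z ^ n = 1 \<longrightarrow> f_fun p h c z \<noteq> 0"
  shows "invertible_mat (A_mat p c)"
proof (rule invertible_mat_det[OF A_mat_carrier])
  show "det (A_mat p c) \<noteq> 0"
    using assms z_root_pow[of p] p_gt by (simp add: det_A_mat)
qed

section \<open>The reversal and the sign eigenvector\<close>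

lemma reversal_mat_nu: "reversal_mat n *\<^sub>v nu_vec p h l = (- 1) ^ l \<cdot>\<^sub>v nu_vec p h l"
proof (rule eq_vecI)
  show "dim_vec (reversal_mat n *\<^sub>v nu_vec p h l) = dim_vec ((- 1) ^ l \<cdot>\<^sub>v nu_vec p h l)"
    using nu_vec_carrier[of l] by (auto simp: reversal_mat_def)
  fix i assume "i < dim_vec ((- 1) ^ l \<cdot>\<^sub>v nu_vec p h l)"
  then have i: "i < n"
    using nu_vec_carrier[of l] by auto
  then obtain a where a: "i = pos a"
    using pos_cases by metis
  have "(reversal_mat n *\<^sub>v nu_vec p h l) $ i =
        (\<Sum>j\<in>{0..<n}. (if Suc i + Suc j = n + 1 then 1 else 0) * nu_vec p h l $ j)"
    using i by (simp add: reversal_mat_def scalar_prod_def)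
  also have "\<dots> = (\<Sum>j\<in>{0..<n}. if j = n - Suc i then nu_vec p h l $ j else 0)"
  proof (rule sum.cong)
    fix j assume "j \<in> {0..<n}"
    have "Suc i + Suc j = n + 1 \<longleftrightarrow> j = n - Suc i"
      using i by linarith
    then show "(if Suc i + Suc j = n + 1 then 1 else 0) * nu_vec p h l $ j =
        (if j = n - Suc i then nu_vec p h l $ j else 0)"
      by simp
  qed simp
  also have "\<dots> = nu_vec p h l $ (n - Suc i)"
    using i by simp
  \<comment> \<open>The reversed index has exponent \<open>a + n div 2\<close>; the extra half
    period yields the sign by \<open>z_root_half\<close>.\<close>
  also have "\<dots> = z_root p l ^ (a + n div 2)"
    by (simp only: a nu_vec_pos flip: pos_add_half)
  also have "\<dots> = ((- 1) ^ l \<cdot>\<^sub>v nu_vec p h l) $ i"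
    using i p p_gt nu_vec_carrier[of l] by (simp add: a nu_vec_pos power_add z_root_half)
  finally show "(reversal_mat n *\<^sub>v nu_vec p h l) $ i = ((- 1) ^ l \<cdot>\<^sub>v nu_vec p h l) $ i" .
qed

lemma reversal_mat_nu_even: "even l \<Longrightarrow> reversal_mat n *\<^sub>v nu_vec p h l = nu_vec p h l"
  by (simp add: reversal_mat_nu)

lemma reversal_mat_nu_odd: "odd l \<Longrightarrow> reversal_mat n *\<^sub>v nu_vec p h l = - nu_vec p h l"
  by (auto simp: reversal_mat_nu)

text \<open>The character with root -1, at index \<open>(p - 1) div 2\<close>, has entries 1 and -1;
  whether this index is even or odd is decided by \<open>p\<close> modulo 4.\<close>

lemma sign_eigenvector:
  "\<exists>v ev. eigenvector (A_mat p c) v ev \<and> (\<forall>k\<in>{1..n}. vec_entry v k \<in> {1, - 1}) \<and>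
     ([p = 1] (mod 4) \<longrightarrow> reversal_mat n *\<^sub>v v = v) \<and>
     ([p = 3] (mod 4) \<longrightarrow> reversal_mat n *\<^sub>v v = - v)"
proof (intro exI conjI ballI impI)
  let ?l = "n div 2"
  show "eigenvector (A_mat p c) (nu_vec p h ?l) (f_fun p h c (z_root p ?l))"
    by (rule eigenvector_nu)
  have z: "z_root p ?l = - 1"
  proof -
    have half: "real ?l = real n / 2"
      using arg_cong[OF n_eq(1), of real] by linarith
    have "2 * pi * real ?l / real n = pi"
      unfolding half using p_gt by simp
    then show ?thesis
      by (simp only: z_root_cis cis_pi)
  qed
  show "vec_entry (nu_vec p h ?l) k \<in> {1, - 1}" if "k \<in> {1..n}" for k
  proof -
    have "k - 1 < n"
      using that unfolding atLeastAtMost_iff by linarith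
    then obtain a where "k - 1 = pos a"
      using pos_cases by metis
    then show ?thesis
      by (cases "even a") (simp_all add: nu_vec_pos z)
  qed
  show "reversal_mat n *\<^sub>v nu_vec p h ?l = nu_vec p h ?l" if "[p = 1] (mod 4)"
  proof (rule reversal_mat_nu_even)
    show "even ?l"
      using that p_gt unfolding cong_def by presburger
  qed
  show "reversal_mat n *\<^sub>v nu_vec p h ?l = - nu_vec p h ?l" if "[p = 3] (mod 4)"
  proof (rule reversal_mat_nu_odd)
    show "odd ?l"
      using that p_gt unfolding cong_def by presburger
  qed
qed

end

theorem theorem2p11:
  fixes p h :: nat and c :: "complex vec"
  assumes p: "prime p" "odd p"
    and c: "c \<in> carrier_vec (p - 1)"
    and h: "primitive_mod p h"
  shows
    "(inj_on (vec_entry c) {1..p - 1} \<longrightarrow> latin_square_mat (A_mat p c)) \<and>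
     centrosymmetric_mat (A_mat p c) \<and>
     (\<forall>i\<in>{1..p - 1}. mat_entry (A_mat p c) i i = vec_entry c 1 \<and>
                     mat_entry (A_mat p c) i (p - i) = vec_entry c (p - 1)) \<and>
     permutation_similar_mat (A_mat p c)
       (circulant_mat (vec (p - 1) (\<lambda>k. vec_entry c (h ^ k mod p)))) \<and>
     normal_mat (A_mat p c) \<and>
     ((\<forall>l\<in>{1..p - 1}. eigenvector (A_mat p c) (nu_vec p h l) (f_fun p h c (z_root p l))) \<and>
      basis_family (p - 1) (nu_vec p h) {1..p - 1}) \<and>
     ((\<forall>l\<in>{1..p - 1}.
         (even l \<longrightarrow> reversal_mat (p - 1) *\<^sub>v nu_vec p h l = nu_vec p h l) \<and>
         (odd l \<longrightarrow> reversal_mat (p - 1) *\<^sub>v nu_vec p h l = - nu_vec p h l)) \<and>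
      (\<exists>v ev. eigenvector (A_mat p c) v ev \<and>
         (\<forall>k\<in>{1..p - 1}. vec_entry v k \<in> {1, - 1}) \<and>
         ([p = 1] (mod 4) \<longrightarrow> reversal_mat (p - 1) *\<^sub>v v = v) \<and>
         ([p = 3] (mod 4) \<longrightarrow> reversal_mat (p - 1) *\<^sub>v v = - v))) \<and>
     (det (A_mat p c) = (\<Prod>l=1..p - 1. f_fun p h c (z_root p l)) \<and>
      ((\<forall>z. z ^ (p - 1) = 1 \<longrightarrow> f_fun p h c z \<noteq> 0) \<longrightarrow> invertible_mat (A_mat p c))) \<and>
     (\<forall>c1\<in>carrier_vec (p - 1). \<forall>c2\<in>carrier_vec (p - 1).
        commuting_family {A_mat p c1, A_mat p c2,
                          mat_adjoint (A_mat p c1), mat_adjoint (A_mat p c2)})"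
proof -
  interpret odd_prime_primitive p h
    by unfold_locales (use p h in auto)
  show ?thesis
    by (intro conjI ballI impI latin_square_A_mat centrosymmetric_A_mat diagonals_A_mat
        permutation_similar_A_mat normal_A_mat eigenvector_nu basis_nu reversal_mat_nu_even
        reversal_mat_nu_odd sign_eigenvector det_A_mat invertible_A_mat commuting_family_A_mat)
qed

end
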